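(* Let $(x_j)_{j\in J}$ be a frame for $\mathbb{R}^n$, and let $\lambda_c$ be the critical value for $(x_j)_{j\in J}$ to do $\lambda_c$-saturation recovery on $B_{\mathbb{R}^n}$. Then for all $\lambda>\lambda_c$ there exists $C_\lambda>0$ such that $(x_j)_{j\in J}$ does $C_\lambda$-stable $\lambda$-saturation recovery on $B_{\mathbb{R}^n}$.
   Context: A family $(x_j)_{j\in J}$ in a Hilbert space $H$ is a frame of $H$ if there are $A,B>0$ with $A\|x\|^2\le\sum_{j\in J}|\langle x,x_j\rangle|^2\le B\|x\|^2$ for all $x\in H$. Its analysis operator is $\Theta:H\to\ell_2(J)$, $\Theta x=(\langle x,x_j\rangle)_{j\in J}$. For $\lambda>0$, $\phi_\lambda:\mathbb{R}\to[-\lambda,\lambda]$ is given by $\phi_\lambda(t)=t$ if $|t|\le\lambda$ and $\phi_\lambda(t)=\mathrm{sign}(t)\lambda$ if $|t|>\lambda$, and $\Phi_\lambda((a_j)_{j\in J})=(\phi_\lambda(a_j))_{j\in J}$ on $\ell_2(J)$. The frame does $\lambda$-saturation recovery on $X\subseteq H$ if $\Phi_\lambda\Theta|_X$ is one-to-one, and does $C$-stable $\lambda$-saturation recovery on $X$ (for $C>0$) if $\|x-y\|\le C\|\Phi_\lambda\Theta x-\Phi_\lambda\Theta y\|$ for all $x,y\in X$. $B_{\mathbb{R}^n}$ is the closed Euclidean unit ball. The critical value $\lambda_c$ is the infimum of all $\lambda>0$ such that the frame does $\lambda$-saturation recovery on $B_{\mathbb{R}^n}$. *)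

theory Defs
  imports "HOL-Analysis.Analysis"
begin

text \<open>
  A family indexed by a set \<open>J\<close> of arbitrary cardinality is a function on the index type of which
  only the values on \<open>J\<close> matter. Elements of $\ell_2(J)$ are represented as functions that are
  extensional on \<open>J\<close>, so that equality of functions is equality of families over \<open>J\<close>.
\<close>

definition is_frame ::
    "'j set \<Rightarrow> ('j \<Rightarrow> 'a::{real_inner,complete_space}) \<Rightarrow> bool" where
  "is_frame J f \<longleftrightarrow>
     (\<exists>A>0. \<exists>B>0. \<forall>x.
        (\<lambda>j. \<bar>x \<bullet> f j\<bar>\<^sup>2) summable_on J \<and>
        A * (norm x)\<^sup>2 \<le> (\<Sum>\<^sub>\<infinity>j\<in>J. \<bar>x \<bullet> f j\<bar>\<^sup>2) \<and>
        (\<Sum>\<^sub>\<infinity>j\<in>J. \<bar>x \<bullet> f j\<bar>\<^sup>2) \<le> B * (norm x)\<^sup>2)"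

definition ell2 :: "'j set \<Rightarrow> ('j \<Rightarrow> real) set" where
  "ell2 J = {a \<in> extensional J. (\<lambda>j. (a j)\<^sup>2) summable_on J}"

definition ell2_norm :: "'j set \<Rightarrow> ('j \<Rightarrow> real) \<Rightarrow> real" where
  "ell2_norm J a = sqrt (\<Sum>\<^sub>\<infinity>j\<in>J. (a j)\<^sup>2)"

definition analysis_op ::
    "'j set \<Rightarrow> ('j \<Rightarrow> 'a::{real_inner,complete_space}) \<Rightarrow> 'a \<Rightarrow> 'j \<Rightarrow> real" where
  "analysis_op J f x = (\<lambda>j\<in>J. x \<bullet> f j)"

definition sat :: "real \<Rightarrow> real \<Rightarrow> real" where
  "sat l t = (if \<bar>t\<bar> \<le> l then t else sgn t * l)"

definition sat_op :: "real \<Rightarrow> 'j set \<Rightarrow> ('j \<Rightarrow> real) \<Rightarrow> 'j \<Rightarrow> real" where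
  "sat_op l J a = (\<lambda>j\<in>J. sat l (a j))"

definition saturation_recovery ::
    "real \<Rightarrow> 'j set \<Rightarrow> ('j \<Rightarrow> 'a::{real_inner,complete_space}) \<Rightarrow> 'a set \<Rightarrow> bool" where
  "saturation_recovery l J f X \<longleftrightarrow> inj_on (sat_op l J \<circ> analysis_op J f) X"

definition stable_saturation_recovery ::
    "real \<Rightarrow> real \<Rightarrow> 'j set \<Rightarrow> ('j \<Rightarrow> 'a::{real_inner,complete_space}) \<Rightarrow> 'a set \<Rightarrow> bool" where
  "stable_saturation_recovery C l J f X \<longleftrightarrow>
     (\<forall>x\<in>X. \<forall>y\<in>X. norm (x - y) \<le>
        C * ell2_norm J (\<lambda>j\<in>J. sat_op l J (analysis_op J f x) j - sat_op l J (analysis_op J f y) j))"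

text \<open>
  The set below is bounded below by \<open>0\<close>, and for a frame it is nonempty: the upper frame bound \<open>B\<close>
  gives \<open>norm (f j) \<le> sqrt B\<close> for \<open>j \<in> J\<close>, so nothing in the unit ball is saturated at
  level \<open>sqrt B\<close>. Hence the real-valued \<open>Inf\<close> is the genuine infimum.
\<close>

definition critical_value :: "'j set \<Rightarrow> ('j \<Rightarrow> 'a::{real_inner,complete_space}) \<Rightarrow> real" where
  "critical_value J f = Inf {l. l > 0 \<and> saturation_recovery l J f (cball 0 1)}"

text \<open>
  The infinite sums in \<open>stable_saturation_recovery\<close> converge for a frame, so \<open>ell2_norm\<close> is
  applied only to elements of \<open>ell2 J\<close>.
\<close>

lemma analysis_op_in_ell2: "is_frame J f \<Longrightarrow> analysis_op J f x \<in> ell2 J"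
proof -
  assume "is_frame J f"
  then have "(\<lambda>j. (x \<bullet> f j)\<^sup>2) summable_on J"
    unfolding is_frame_def by auto
  then show ?thesis
    unfolding ell2_def analysis_op_def by (simp cong: summable_on_cong)
qed

lemma sat_lipschitz: "l > 0 \<Longrightarrow> \<bar>sat l s - sat l t\<bar> \<le> \<bar>s - t\<bar>"
  unfolding sat_def sgn_if by auto

lemma sat_op_diff_in_ell2:
  assumes "is_frame J f" and "l > 0"
  shows "(\<lambda>j\<in>J. sat_op l J (analysis_op J f x) j - sat_op l J (analysis_op J f y) j) \<in> ell2 J"
proof -
  have "(\<lambda>j. ((x - y) \<bullet> f j)\<^sup>2) summable_on J"
    using assms(1) unfolding is_frame_def by auto
  then have "(\<lambda>j. (sat l (x \<bullet> f j) - sat l (y \<bullet> f j))\<^sup>2) summable_on J"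
  proof (rule summable_on_comparison_test)
    fix j
    show "(sat l (x \<bullet> f j) - sat l (y \<bullet> f j))\<^sup>2 \<le> ((x - y) \<bullet> f j)\<^sup>2"
      using sat_lipschitz[OF assms(2), of "x \<bullet> f j" "y \<bullet> f j"]
      by (simp add: abs_le_square_iff inner_diff_left)
  qed simp
  then show ?thesis
    unfolding ell2_def analysis_op_def sat_op_def by (simp cong: summable_on_cong)
qed

end

theory Submission
  imports Defs
begin

text \<open>
  Suppose stability fails at \<open>l\<close>. Then there are \<open>x\<^sub>m, y\<^sub>m\<close> in the ball with
  \<open>norm (x\<^sub>m - y\<^sub>m)\<close> larger than \<open>m\<close> times the distance of the saturated measurements; by compactness
  and recovery at \<open>l\<close>, both sequences may be assumed to converge to the same point \<open>x\<close>. Pick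
  \<open>l0 < l' < l\<close> with recovery at \<open>l0\<close>. Those \<open>f j\<close> with \<open>\<bar>x \<bullet> f j\<bar> \<le> l'\<close> span the space: if \<open>z\<close> were
  orthogonal to all of them, then \<open>r *\<^sub>R x\<close> and \<open>r *\<^sub>R x + t *\<^sub>R z\<close>, with \<open>r < 1\<close> close to \<open>1\<close> and small \<open>t\<close>,
  would have the same saturated measurements at \<open>l0\<close>. Hence finitely many of them bound \<open>norm\<close> from
  above, and near \<open>x\<close> their measurements are not saturated at \<open>l\<close>.
\<close>

section \<open>Clipping, and how recovery depends on the level\<close>

lemma sat_eq_max_min: "l > 0 \<Longrightarrow> sat l t = max (-l) (min l t)"
  unfolding sat_def sgn_if by auto

lemma sat_sat: "0 < k \<Longrightarrow> k \<le> l \<Longrightarrow> sat k (sat l t) = sat k t"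
  by (simp add: sat_eq_max_min)

text \<open>The measurement map at level \<open>k\<close> factors through the one at level
  \<open>l\<close>, and the inner factor of an injective composition is injective.\<close>

lemma saturation_recovery_mono:
  assumes "0 < k" "k \<le> l" "saturation_recovery k J f X"
  shows "saturation_recovery l J f X"
proof -
  have "sat_op k J \<circ> analysis_op J f = sat_op k J \<circ> (sat_op l J \<circ> analysis_op J f)"
    using assms(1,2) by (auto simp: fun_eq_iff sat_op_def sat_sat)
  then show ?thesis
    using assms(3) inj_on_imageI2[of "sat_op k J" "sat_op l J \<circ> analysis_op J f" X]
    unfolding saturation_recovery_def by simp
qed

lemma saturation_recoveryD:
  assumes "saturation_recovery l J f X" "x \<in> X" "y \<in> X"
    and "\<And>j. j \<in> J \<Longrightarrow> sat l (x \<bullet> f j) = sat l (y \<bullet> f j)"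
  shows "x = y"
proof -
  have "(sat_op l J \<circ> analysis_op J f) x = (sat_op l J \<circ> analysis_op J f) y"
    using assms(4) by (auto simp: fun_eq_iff sat_op_def analysis_op_def restrict_def)
  then show ?thesis
    using assms(1-3) unfolding saturation_recovery_def by (meson inj_onD)
qed

text \<open>Test the upper frame bound on \<open>f j\<close> itself and keep only the term of index
  \<open>j\<close>, which is the fourth power of \<open>norm (f j)\<close>.\<close>

lemma frame_norm_bounded:
  assumes "is_frame J f"
  obtains M where "M > 0" "\<And>j. j \<in> J \<Longrightarrow> norm (f j) \<le> M"
proof -
  obtain B where "B > 0" and
    B: "\<And>x. (\<lambda>j. \<bar>x \<bullet> f j\<bar>\<^sup>2) summable_on J" "\<And>x. (\<Sum>\<^sub>\<infinity>j\<in>J. \<bar>x \<bullet> f j\<bar>\<^sup>2) \<le> B * (norm x)\<^sup>2"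
    using assms unfolding is_frame_def by blast
  show ?thesis
  proof (rule that[of "sqrt B"])
    fix j assume "j \<in> J"
    then have "(\<Sum>i\<in>{j}. \<bar>f j \<bullet> f i\<bar>\<^sup>2) \<le> (\<Sum>\<^sub>\<infinity>i\<in>J. \<bar>f j \<bullet> f i\<bar>\<^sup>2)"
      by (intro finite_sum_le_infsum B) auto
    also have "\<dots> \<le> B * (norm (f j))\<^sup>2" by (rule B)
    finally have le: "(norm (f j))\<^sup>2 * (norm (f j))\<^sup>2 \<le> B * (norm (f j))\<^sup>2"
      by (simp add: dot_square_norm power2_eq_square)
    have "(norm (f j))\<^sup>2 \<le> B"
    proof (cases "f j = 0")
      case False
      then show ?thesis by (intro mult_right_le_imp_le[OF le]) simp
    qed (use \<open>B > 0\<close> in simp)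
    then show "norm (f j) \<le> sqrt B" by (rule real_le_rsqrt)
  qed (use \<open>B > 0\<close> in simp)
qed

section \<open>The distance between saturated measurements\<close>

definition sat_dist ::
    "real \<Rightarrow> 'j set \<Rightarrow> ('j \<Rightarrow> 'a::{real_inner,complete_space}) \<Rightarrow> 'a \<Rightarrow> 'a \<Rightarrow> real" where
  "sat_dist l J f x y =
     ell2_norm J (\<lambda>j\<in>J. sat_op l J (analysis_op J f x) j - sat_op l J (analysis_op J f y) j)"

lemma sat_dist_nonneg: "sat_dist l J f x y \<ge> 0"
  unfolding sat_dist_def ell2_norm_def by (simp add: infsum_nonneg)

text \<open>Partial sums of nonnegative terms stay below the infinite sum. This rests on
  summability, since \<open>infsum\<close> defaults to 0 on families that are not summable.\<close>

lemma sum_le_sat_dist: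
  assumes "is_frame J f" "l > 0" "finite K" "K \<subseteq> J"
  shows "(\<Sum>k\<in>K. (sat l (x \<bullet> f k) - sat l (y \<bullet> f k))\<^sup>2) \<le> (sat_dist l J f x y)\<^sup>2"
proof -
  define a where
    "a = (\<lambda>j\<in>J. sat_op l J (analysis_op J f x) j - sat_op l J (analysis_op J f y) j)"
  have "(\<lambda>j. (a j)\<^sup>2) summable_on J"
    using sat_op_diff_in_ell2[OF assms(1,2)] unfolding a_def ell2_def by blast
  then have "(\<Sum>k\<in>K. (a k)\<^sup>2) \<le> (\<Sum>\<^sub>\<infinity>j\<in>J. (a j)\<^sup>2)"
    using assms(3,4) by (intro finite_sum_le_infsum) auto
  also have "\<dots> = (sat_dist l J f x y)\<^sup>2"
    unfolding sat_dist_def ell2_norm_def a_def by (simp add: infsum_nonneg)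
  also have "(\<Sum>k\<in>K. (a k)\<^sup>2) = (\<Sum>k\<in>K. (sat l (x \<bullet> f k) - sat l (y \<bullet> f k))\<^sup>2)"
    using assms(4) by (intro sum.cong) (auto simp: a_def sat_op_def analysis_op_def)
  finally show ?thesis .
qed

section \<open>Linear algebra: finitely many unsaturated frame vectors control the norm\<close>

text \<open>In finite dimension a maximal independent subset of the family is finite and has the
  same orthogonal complement. The quadratic form \<open>g\<close> of its members is therefore
  positive off 0, has a positive minimum on the compact unit sphere, and scales by
  homogeneity.\<close>

lemma total_family_lower_bound:
  fixes f :: "'j \<Rightarrow> 'a::euclidean_space"
  assumes total: "\<And>z. (\<And>j. j \<in> I \<Longrightarrow> z \<bullet> f j = 0) \<Longrightarrow> z = 0"
  obtains K c where "finite K" "K \<subseteq> I" "c > 0" "\<And>z. c * (norm z)\<^sup>2 \<le> (\<Sum>k\<in>K. (z \<bullet> f k)\<^sup>2)"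
proof -
  obtain B where B: "B \<subseteq> f ` I" "independent B" "f ` I \<subseteq> span B"
    using maximal_independent_subset by blast
  have "finite B" using B(2) by (rule independent_imp_finite)
  \<comment> \<open>\<open>B\<close> consists of vectors; \<open>K\<close> picks finitely many
    indices in \<open>I\<close> that represent them.\<close>
  then obtain K where K: "K \<subseteq> I" "finite K" "B = f ` K"
    using B(1) by (meson finite_subset_image)
  define g where "g = (\<lambda>z. \<Sum>k\<in>K. (z \<bullet> f k)\<^sup>2)"
  have pos: "g z > 0" if "z \<noteq> 0" for z
  proof (rule ccontr)
    assume "\<not> g z > 0"
    moreover have "g z \<ge> 0" unfolding g_def by (simp add: sum_nonneg)
    ultimately have "g z = 0" by simp
    then have "\<And>k. k \<in> K \<Longrightarrow> z \<bullet> f k = 0"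
      unfolding g_def using K(2) by (simp add: sum_nonneg_eq_0_iff)
    then have "\<And>b. b \<in> B \<Longrightarrow> orthogonal z b"
      using K(3) by (auto simp: orthogonal_def)
    then have "\<And>v. v \<in> span B \<Longrightarrow> orthogonal z v"
      using orthogonal_to_span by blast
    then have "z = 0"
      using B(3) by (intro total) (auto simp: orthogonal_def)
    with that show False by simp
  qed
  have "continuous_on (sphere 0 1) g"
    unfolding g_def by (intro continuous_intros)
  moreover have "sphere (0::'a) 1 \<noteq> {}" by simp
  ultimately obtain w where w: "w \<in> sphere 0 1" "\<And>z. z \<in> sphere 0 1 \<Longrightarrow> g w \<le> g z"
    using continuous_attains_inf[OF compact_sphere] by blast
  show ?thesis
  proof (rule that[of K "g w"])
    show "g w > 0" using w(1) by (intro pos) auto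
    fix z :: 'a
    show "g w * (norm z)\<^sup>2 \<le> (\<Sum>k\<in>K. (z \<bullet> f k)\<^sup>2)"
    proof (cases "z = 0")
      case False
      have "g w \<le> g (z /\<^sub>R norm z)" using False by (intro w) simp
      also have "\<dots> = g z / (norm z)\<^sup>2"
        unfolding g_def by (simp add: sum_divide_distrib power_mult_distrib field_simps)
      finally show ?thesis using False by (simp add: g_def field_simps)
    qed (simp add: sum_nonneg)
  qed (use K in auto)
qed

lemma unsaturated_total:
  fixes f :: "'j \<Rightarrow> 'a::{real_inner,complete_space}"
  assumes "is_frame J f" "0 < k" "k < l" "saturation_recovery k J f (cball 0 1)"
    and "norm x \<le> 1"
    and z: "\<And>j. j \<in> J \<Longrightarrow> \<bar>x \<bullet> f j\<bar> \<le> l \<Longrightarrow> z \<bullet> f j = 0"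
  shows "z = 0"
proof (rule ccontr)
  assume "z \<noteq> 0"
  obtain M where M: "M > 0" "\<And>j. j \<in> J \<Longrightarrow> norm (f j) \<le> M"
    using frame_norm_bounded[OF assms(1)] by blast
  \<comment> \<open>Scaling by \<open>r\<close> takes the level \<open>l\<close> to
    \<open>m\<close>, still above \<open>k\<close>, and leaves room \<open>1 - r\<close> in the unit
    ball. The first bound in \<open>t\<close> keeps the perturbed point in the ball; the second
    moves each measurement by at most \<open>m - k\<close>.\<close>
  define m where "m = (k + l) / 2"
  define r where "r = m / l"
  define t where "t = min (1 - r) ((m - k) / M) / norm z"
  have m: "k < m" "m < l" using assms(3) by (auto simp: m_def)
  have r: "0 < r" "r < 1" "r * l = m"
    using m assms(2) by (auto simp: r_def)
  have t: "t > 0" "t * norm z \<le> 1 - r" "t * norm z \<le> (m - k) / M"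
    using \<open>z \<noteq> 0\<close> r m M(1) by (auto simp: t_def)
  define y where "y = r *\<^sub>R x"
  have ny: "norm y \<le> r" using r assms(5) by (simp add: y_def mult_left_le)
  have "norm (y + t *\<^sub>R z) \<le> norm y + t * norm z"
    using norm_triangle_ineq[of y "t *\<^sub>R z"] t(1) by simp
  also have "\<dots> \<le> 1" using ny t(2) by simp
  finally have "norm (y + t *\<^sub>R z) \<le> 1" .
  moreover have "sat k (y \<bullet> f j) = sat k ((y + t *\<^sub>R z) \<bullet> f j)" if j: "j \<in> J" for j
  proof (cases "\<bar>x \<bullet> f j\<bar> \<le> l")
    case True
    then show ?thesis using z[OF j] by (simp add: inner_left_distrib)
  next
    case False
    have "\<bar>(t *\<^sub>R z) \<bullet> f j\<bar> \<le> (t * norm z) * norm (f j)"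
      using Cauchy_Schwarz_ineq2[of "t *\<^sub>R z" "f j"] t(1) by simp
    also have "\<dots> \<le> ((m - k) / M) * M"
      using t m M j by (intro mult_mono) auto
    finally have d: "\<bar>(t *\<^sub>R z) \<bullet> f j\<bar> \<le> m - k" using M(1) by simp
    have "r * l < r * \<bar>x \<bullet> f j\<bar>"
      using False r(1) by (intro mult_strict_left_mono) auto
    then have "m < \<bar>y \<bullet> f j\<bar>" using r by (simp add: y_def abs_mult)
    \<comment> \<open>A measurement beyond \<open>m\<close> in absolute value that moves by at most
      \<open>m - k\<close> keeps its sign and does not drop below \<open>k\<close>, so both values
      clip to the same endpoint.\<close>
    then show ?thesis
      using d m assms(2) unfolding sat_eq_max_min[OF assms(2)] inner_left_distrib
      by linarith
  qed
  ultimately have "y = y + t *\<^sub>R z"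
    using ny r by (intro saturation_recoveryD[OF assms(4)]) auto
  then show False using t(1) \<open>z \<noteq> 0\<close> by simp
qed

text \<open>Totality is applied at a level \<open>m\<close> strictly between \<open>k\<close> and
  \<open>l\<close>. The margin \<open>l - m\<close> keeps the selected measurements unsaturated at
  \<open>l\<close> throughout a ball around \<open>x\<close>, so there they are linear and bound
  \<open>norm (u - v)\<close>.\<close>

lemma locally_stable:
  fixes f :: "'j \<Rightarrow> 'a::euclidean_space"
  assumes "is_frame J f" "0 < k" "k < l" "saturation_recovery k J f (cball 0 1)"
    and "norm x \<le> 1"
  obtains d C where "d > 0" "C > 0"
    "\<And>u v. u \<in> ball x d \<Longrightarrow> v \<in> ball x d \<Longrightarrow> norm (u - v) \<le> C * sat_dist l J f u v"
proof -
  define m where "m = (k + l) / 2"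
  have m: "k < m" "m < l" using assms(3) by (auto simp: m_def)
  define I where "I = {j \<in> J. \<bar>x \<bullet> f j\<bar> \<le> m}"
  have tot: "z = 0" if "\<And>j. j \<in> I \<Longrightarrow> z \<bullet> f j = 0" for z
    using that unsaturated_total[OF assms(1,2) m(1) assms(4,5), of z] by (auto simp: I_def)
  obtain K c where K: "finite K" "K \<subseteq> I" and c: "c > 0"
    "\<And>z. c * (norm z)\<^sup>2 \<le> (\<Sum>k\<in>K. (z \<bullet> f k)\<^sup>2)"
    using total_family_lower_bound[of I f, OF tot] by blast
  obtain M where M: "M > 0" "\<And>j. j \<in> J \<Longrightarrow> norm (f j) \<le> M"
    using frame_norm_bounded[OF assms(1)] by blast
  have l: "l > 0" using assms by simp
  have near: "sat l (u \<bullet> f j) = u \<bullet> f j" if "u \<in> ball x ((l - m) / M)" "j \<in> K" for u j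
  proof -
    have j: "j \<in> J" "\<bar>x \<bullet> f j\<bar> \<le> m" using that(2) K by (auto simp: I_def)
    have "\<bar>(u - x) \<bullet> f j\<bar> \<le> norm (u - x) * norm (f j)"
      by (rule Cauchy_Schwarz_ineq2)
    also have "\<dots> \<le> ((l - m) / M) * M"
      using that(1) M j m by (intro mult_mono) (auto simp: dist_norm norm_minus_commute)
    finally have "\<bar>u \<bullet> f j - x \<bullet> f j\<bar> \<le> l - m" using M(1) by (simp add: inner_diff_left)
    then have "\<bar>u \<bullet> f j\<bar> \<le> l" using j(2) by linarith
    then show ?thesis by (simp add: sat_def)
  qed
  show ?thesis
  \<comment> \<open>Moving by less than \<open>(l - m) / M\<close> changes a measurement by at most
    \<open>l - m\<close>; the constant comes from taking the root of the quadratic bound with factor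
    \<open>c\<close>.\<close>
  proof (rule that[of "(l - m) / M" "1 / sqrt c"])
    fix u v assume uv: "u \<in> ball x ((l - m) / M)" "v \<in> ball x ((l - m) / M)"
    have "c * (norm (u - v))\<^sup>2 \<le> (\<Sum>k\<in>K. ((u - v) \<bullet> f k)\<^sup>2)" by (rule c)
    also have "\<dots> = (\<Sum>k\<in>K. (sat l (u \<bullet> f k) - sat l (v \<bullet> f k))\<^sup>2)"
      using near uv by (intro sum.cong) (auto simp: inner_diff_left)
    also have "\<dots> \<le> (sat_dist l J f u v)\<^sup>2"
      using K by (intro sum_le_sat_dist assms l) (auto simp: I_def)
    finally have "sqrt (c * (norm (u - v))\<^sup>2) \<le> sqrt ((sat_dist l J f u v)\<^sup>2)"
      by (rule real_sqrt_le_mono)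
    then show "norm (u - v) \<le> 1 / sqrt c * sat_dist l J f u v"
      using c(1) by (simp add: real_sqrt_mult sat_dist_nonneg field_simps)
  qed (use m M c in auto)
qed

section \<open>From local to uniform stability by compactness\<close>

lemma stable_above_recovery:
  fixes f :: "'j \<Rightarrow> 'a::euclidean_space"
  assumes "is_frame J f" "0 < k" "k < l" "saturation_recovery k J f (cball 0 1)"
  shows "\<exists>C>0. stable_saturation_recovery C l J f (cball 0 1)"
proof (rule ccontr)
  assume unstable: "\<not> ?thesis"
  have l: "l > 0" using assms by simp
  \<comment> \<open>The constant tried is \<open>Suc n\<close> because it must be positive. Each
    offending pair is one point of the product, so that a single subsequence makes both coordinates
    converge.\<close>
  have "\<exists>p \<in> cball 0 1 \<times> cball 0 1.
      norm (fst p - snd p) > Suc n * sat_dist l J f (fst p) (snd p)" for n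
  proof -
    have "\<not> stable_saturation_recovery (Suc n) l J f (cball 0 1)"
      using unstable of_nat_0_less_iff zero_less_Suc by blast
    then obtain x y where "x \<in> cball 0 1" "y \<in> cball 0 1"
      "norm (x - y) > Suc n * sat_dist l J f x y"
      unfolding stable_saturation_recovery_def sat_dist_def[symmetric] by (meson not_le)
    then show ?thesis by (intro bexI[of _ "(x, y)"]) auto
  qed
  then obtain p where p: "\<And>n. p n \<in> cball 0 1 \<times> cball 0 1"
    "\<And>n. norm (fst (p n) - snd (p n)) > Suc n * sat_dist l J f (fst (p n)) (snd (p n))"
    by metis
  have "compact (cball (0::'a) 1 \<times> cball (0::'a) 1)" by (intro compact_Times compact_cball)
  then obtain q s where q: "q \<in> cball 0 1 \<times> cball 0 1" "strict_mono s" "(p \<circ> s) \<longlonglongrightarrow> q"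
    using p(1) unfolding compact_def by meson
  define u where "u = (\<lambda>n. fst (p (s n)))"
  define v where "v = (\<lambda>n. snd (p (s n)))"
  have lim: "u \<longlonglongrightarrow> fst q" "v \<longlonglongrightarrow> snd q"
    using tendsto_fst[OF q(3)] tendsto_snd[OF q(3)] by (auto simp: u_def v_def o_def)
  have uv: "norm (u n) \<le> 1" "norm (v n) \<le> 1" for n
    using p(1)[of "s n"] by (auto simp: u_def v_def mem_Times_iff)
  \<comment> \<open>Since \<open>n \<le> s n\<close>, the factor \<open>Suc (s n)\<close> along the
    subsequence may be lowered to \<open>Suc n\<close>.\<close>
  have gap: "norm (u n - v n) > Suc n * sat_dist l J f (u n) (v n)" for n
  proof -
    have "real (Suc n) * sat_dist l J f (u n) (v n) \<le> Suc (s n) * sat_dist l J f (u n) (v n)"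
      using seq_suble[OF q(2), of n] by (intro mult_right_mono sat_dist_nonneg) auto
    with p(2)[of "s n"] show ?thesis unfolding u_def v_def by linarith
  qed
  \<comment> \<open>Points of the ball are at distance at most 2, so the growing factor in
    \<open>gap\<close> forces the saturated distance to 0.\<close>
  have le: "sat_dist l J f (u n) (v n) \<le> 2 / Suc n" for n
  proof -
    have "norm (u n - v n) \<le> 2"
      using norm_triangle_ineq4[of "u n" "v n"] uv[of n] by linarith
    with gap[of n] have "Suc n * sat_dist l J f (u n) (v n) \<le> 2" by linarith
    then show ?thesis by (simp add: field_simps)
  qed
  have dist0: "(\<lambda>n. sat_dist l J f (u n) (v n)) \<longlonglongrightarrow> 0"
  proof (rule Lim_null_comparison)
    show "(\<lambda>n. 2 / real (Suc n)) \<longlonglongrightarrow> 0"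
      by (intro LIMSEQ_Suc lim_const_over_n)
  qed (simp add: sat_dist_nonneg le del: of_nat_Suc)
  \<comment> \<open>Each single measurement is controlled by \<open>sat_dist\<close>, and clipping
    is continuous; hence the two limits have equal saturated measurements.\<close>
  have "sat l (fst q \<bullet> f j) = sat l (snd q \<bullet> f j)" if j: "j \<in> J" for j
  proof -
    have "\<bar>sat l (u n \<bullet> f j) - sat l (v n \<bullet> f j)\<bar> \<le> sat_dist l J f (u n) (v n)" for n
      using sum_le_sat_dist[OF assms(1) l, of "{j}" "u n" "v n"] j
      by (simp add: abs_le_square_iff[symmetric] sat_dist_nonneg)
    then have "(\<lambda>n. sat l (u n \<bullet> f j) - sat l (v n \<bullet> f j)) \<longlonglongrightarrow> 0"
      by (intro Lim_null_comparison[OF always_eventually dist0]) (simp add: real_norm_def)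
    moreover have "(\<lambda>n. sat l (u n \<bullet> f j) - sat l (v n \<bullet> f j))
        \<longlonglongrightarrow> sat l (fst q \<bullet> f j) - sat l (snd q \<bullet> f j)"
      unfolding sat_eq_max_min[OF l] by (intro tendsto_intros lim)
    ultimately show ?thesis using LIMSEQ_unique by fastforce
  qed
  then have eq: "fst q = snd q"
    using q(1) saturation_recovery_mono[OF assms(2) _ assms(4), of l] assms(3)
    by (intro saturation_recoveryD[of l J f "cball 0 1"]) (auto simp: mem_Times_iff)
  have "norm (fst q) \<le> 1" using q(1) by (auto simp: mem_Times_iff)
  then obtain d C where dC: "d > 0" "C > 0" "\<And>u v. u \<in> ball (fst q) d \<Longrightarrow> v \<in> ball (fst q) d \<Longrightarrow>
      norm (u - v) \<le> C * sat_dist l J f u v"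
    using locally_stable[OF assms] by blast
  \<comment> \<open>For large \<open>n\<close> both points lie in the ball of local stability and
    \<open>Suc n\<close> exceeds or equals its constant, which contradicts the strict inequality
    \<open>gap\<close>.\<close>
  have "\<forall>\<^sub>F n in sequentially. u n \<in> ball (fst q) d \<and> v n \<in> ball (fst q) d \<and> C \<le> Suc n"
  proof (intro eventually_conj)
    show "\<forall>\<^sub>F n in sequentially. u n \<in> ball (fst q) d"
      using dC(1) by (intro topological_tendstoD[OF lim(1)]) auto
    show "\<forall>\<^sub>F n in sequentially. v n \<in> ball (fst q) d"
      using dC(1) eq by (intro topological_tendstoD[OF lim(2)]) auto
    show "\<forall>\<^sub>F n in sequentially. C \<le> Suc n"
      by (rule eventually_sequentiallyI[of "nat \<lceil>C\<rceil>"]) linarith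
  qed
  then obtain n where n: "u n \<in> ball (fst q) d" "v n \<in> ball (fst q) d" "C \<le> Suc n"
    by (auto simp: eventually_sequentially)
  have "norm (u n - v n) \<le> C * sat_dist l J f (u n) (v n)" using n dC(3) by blast
  also have "\<dots> \<le> Suc n * sat_dist l J f (u n) (v n)"
    using n(3) by (intro mult_right_mono sat_dist_nonneg)
  finally show False using gap[of n] by simp
qed

section \<open>Recovery levels exist, and the passage to the critical value\<close>

text \<open>At a common bound \<open>M\<close> of the norms nothing in the unit ball is saturated,
  and the lower frame bound makes the analysis operator injective. This makes the set behind
  \<open>critical_value\<close> nonempty.\<close>

lemma frame_saturation_recovery_ex:
  assumes "is_frame J f"
  shows "\<exists>l>0. saturation_recovery l J f (cball 0 1)"
proof -
  obtain M where M: "M > 0" "\<And>j. j \<in> J \<Longrightarrow> norm (f j) \<le> M"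
    using frame_norm_bounded[OF assms] by blast
  obtain A where A: "A > 0" "\<And>x. A * (norm x)\<^sup>2 \<le> (\<Sum>\<^sub>\<infinity>j\<in>J. \<bar>x \<bullet> f j\<bar>\<^sup>2)"
    using assms unfolding is_frame_def by blast
  have unsat: "sat M (x \<bullet> f j) = x \<bullet> f j" if "x \<in> cball 0 1" "j \<in> J" for x j
  proof -
    have "\<bar>x \<bullet> f j\<bar> \<le> norm x * norm (f j)" by (rule Cauchy_Schwarz_ineq2)
    also have "\<dots> \<le> 1 * M" using that M by (intro mult_mono) auto
    finally show ?thesis by (simp add: sat_def)
  qed
  have "x = y" if xy: "x \<in> cball 0 1" "y \<in> cball 0 1"
    and eq: "(sat_op M J \<circ> analysis_op J f) x = (sat_op M J \<circ> analysis_op J f) y" for x y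
  proof -
    have "x \<bullet> f j = y \<bullet> f j" if "j \<in> J" for j
      using fun_cong[OF eq, of j] unsat xy that by (simp add: sat_op_def analysis_op_def)
    then have "(\<Sum>\<^sub>\<infinity>j\<in>J. \<bar>(x - y) \<bullet> f j\<bar>\<^sup>2) = 0"
      by (intro infsum_0) (simp add: inner_diff_left)
    then have "A * (norm (x - y))\<^sup>2 \<le> 0" using A(2)[of "x - y"] by simp
    then show ?thesis using A(1) by (simp add: mult_le_0_iff)
  qed
  then show ?thesis
    using M(1) unfolding saturation_recovery_def by (intro exI[of _ M]) (auto intro: inj_onI)
qed

theorem theorem4p1:
  fixes J :: "'j set" and f :: "'j \<Rightarrow> real ^ 'n"
  assumes "is_frame J f"
  shows "\<forall>l > critical_value J f. \<exists>C>0. stable_saturation_recovery C l J f (cball 0 1)"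
proof (intro allI impI)
  fix l assume "l > critical_value J f"
  then have inf: "Inf {l. l > 0 \<and> saturation_recovery l J f (cball 0 1)} < l"
    unfolding critical_value_def .
  have nonempty: "{l. l > 0 \<and> saturation_recovery l J f (cball 0 1)} \<noteq> {}"
    using frame_saturation_recovery_ex[OF assms] by simp
  \<comment> \<open>An infimum below \<open>l\<close> of a nonempty set leaves a recovery level
    strictly below \<open>l\<close>, the gap that the compactness argument consumes.\<close>
  obtain k where "0 < k" "k < l" "saturation_recovery k J f (cball 0 1)"
    using cInf_lessD[OF nonempty inf] by auto
  then show "\<exists>C>0. stable_saturation_recovery C l J f (cball 0 1)"
    by (rule stable_above_recovery[OF assms])
qed

end
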